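(* Let $M\in\mathbb{N}_0$ and let $(\pi_{i,j})$ be the transition probabilities of the nonincreasing Markov chains $(I_k(n))_{k\in\mathbb{N}_0}$ absorbed at $M$ described in the context. Let $g_{n,k}$ be the probability that the chain started at $n$ ever visits state $k$, and let $Z_n$ be the number of zero decrements of the chain started at $n$ before absorption. Assume that $\lim_{n\to\infty}g_{n,k}=0$ for each integer $k\ge M+1$, that $\lim_{n\to\infty}\pi_{n,n}=0$, and that $$\lim_{n\to\infty}\frac{\pi_{n,n}}{\pi_{n,M}}=c\in(0,\infty).$$ Then, as $n\to\infty$, $Z_n$ converges in distribution to a random variable $Z$ having the geometric distribution (starting at zero) with success probability $(c+1)^{-1}$, i.e. $\mathbb{P}\{Z=m\}=\frac{1}{c+1}\left(\frac{c}{c+1}\right)^m$, $m\in\mathbb{N}_0$.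
   Context: Setting. Fix $M\in\mathbb{N}_0$. For each integer $n\ge M$, $n\in\mathbb{N}$, let $(I_k(n))_{k\in\mathbb{N}_0}$ be a Markov chain on $\{M,M+1,\ldots\}$ with $I_0(n)=n$ and transition probabilities, not depending on $n$, given by $\mathbb{P}\{I_k(n)=j\mid I_{k-1}(n)=i\}=\pi_{i,j}$ for $i\ge M+1$ and $M\le j\le i$; $\mathbb{P}\{I_k(n)=j\mid I_{k-1}(n)=i\}=0$ for $i<j$; and $\mathbb{P}\{I_k(n)=M\mid I_{k-1}(n)=M\}=1$. It is assumed that $\pi_{i,i-1}>0$ for every $i\ge M+1$, so that absorption at $M$ is certain. The number of zero decrements before absorption is $$Z_n:=\#\{k\in\mathbb{N}_0:\ I_k(n)-I_{k+1}(n)=0,\ I_k(n)>M\},$$ which is a.s. finite. Let $(J_k(n))_{k\in\mathbb{N}_0}$ be the decreasing Markov chain with $J_0(n)=n$ obtained from $I$ by deleting zero decrements, i.e. with transition probabilities $\widetilde\pi_{i,j}=\pi_{i,j}/(1-\pi_{i,i})$ for $i>j\ge M$ (absorbed at $M$). For $M<k\le n$, $g_{n,k}:=\sum_{m\ge0}\mathbb{P}\{J_m(n)=k\}$, which is the probability that $J$ (equivalently $I$) started at $n$ visits $k$. *)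

theory Defs
  imports "HOL-Probability.Probability"
begin

text \<open>A (time-homogeneous) Markov chain with countable state space \<open>S\<close> and transition
  probabilities \<open>p\<close>; conditional probabilities are constrained only when the conditioning
  event has positive probability.\<close>

definition markov_chain ::
  "nat set \<Rightarrow> (nat \<Rightarrow> nat \<Rightarrow> real) \<Rightarrow> 'a measure \<Rightarrow> (nat \<Rightarrow> 'a \<Rightarrow> nat) \<Rightarrow> bool" where
  "markov_chain S p P X \<longleftrightarrow>
     prob_space P \<and>
     (\<forall>k. X k \<in> measurable P (count_space S)) \<and>
     (\<forall>k. \<forall>i\<in>S. \<forall>j\<in>S. \<P>(\<omega> in P. X k \<omega> = i) > 0 \<longrightarrow>
        \<P>(\<omega> in P. X (Suc k) \<omega> = j \<bar> X k \<omega> = i) = p i j) \<and>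
     (\<forall>k. \<forall>j\<in>S. \<forall>x. (\<forall>l\<le>k. x l \<in> S) \<and> \<P>(\<omega> in P. \<forall>l\<le>k. X l \<omega> = x l) > 0 \<longrightarrow>
        \<P>(\<omega> in P. X (Suc k) \<omega> = j \<bar> \<forall>l\<le>k. X l \<omega> = x l)
        = \<P>(\<omega> in P. X (Suc k) \<omega> = j \<bar> X k \<omega> = x k))"

text \<open>Only the entries \<open>\<pi> i j\<close> with \<open>i, j \<ge> M\<close> are meaningful.\<close>

definition nonincreasing_transitions :: "nat \<Rightarrow> (nat \<Rightarrow> nat \<Rightarrow> real) \<Rightarrow> bool" where
  "nonincreasing_transitions M \<pi> \<longleftrightarrow>
     (\<forall>i\<ge>M. \<forall>j\<ge>M. \<pi> i j \<ge> 0) \<and>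
     (\<forall>i\<ge>M. (\<Sum>j=M..i. \<pi> i j) = 1) \<and>
     (\<forall>i\<ge>M. \<forall>j>i. \<pi> i j = 0) \<and>
     \<pi> M M = 1 \<and>
     (\<forall>i\<ge>M + 1. \<pi> i (i - 1) > 0)"

definition nonincreasing_chain_from ::
  "nat \<Rightarrow> (nat \<Rightarrow> nat \<Rightarrow> real) \<Rightarrow> nat \<Rightarrow> 'a measure \<Rightarrow> (nat \<Rightarrow> 'a \<Rightarrow> nat) \<Rightarrow> bool" where
  "nonincreasing_chain_from M \<pi> n P X \<longleftrightarrow>
     markov_chain {M..} \<pi> P X \<and> (AE \<omega> in P. X 0 \<omega> = n)"

definition visit_prob :: "'a measure \<Rightarrow> (nat \<Rightarrow> 'a \<Rightarrow> nat) \<Rightarrow> nat \<Rightarrow> real" where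
  "visit_prob P X k = \<P>(\<omega> in P. \<exists>m. X m \<omega> = k)"

text \<open>Number of zero decrements before absorption. The set is finite almost surely; on the
  exceptional null set \<open>card\<close> returns 0.\<close>

definition zero_decrements :: "nat \<Rightarrow> (nat \<Rightarrow> 'a \<Rightarrow> nat) \<Rightarrow> 'a \<Rightarrow> nat" where
  "zero_decrements M X \<omega> = card {k. int (X k \<omega>) - int (X (Suc k) \<omega>) = 0 \<and> X k \<omega> > M}"

end

theory Submission
  imports Defs
begin

text \<open>Let \<open>v n k\<close> be the probability that the chain from \<open>n\<close> visits \<open>k\<close> without an earlier zero
  decrement. The chain ends its zero-free phase at exactly one \<open>k > M\<close>, either by a zero decrement
  or by absorption, so the weights \<open>w n k = v n k * (\<pi> k k + \<pi> k M)\<close> sum to 1 over \<open>k\<close>, and they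
  vanish as \<open>n\<close> grows because \<open>v\<close> is dominated by the visit probabilities. Decomposing at the first
  zero decrement, \<open>P(Z\<^sub>n \<ge> m + 1)\<close> is the \<open>w n\<close>-average over \<open>k\<close> of
  \<open>\<pi> k k / (\<pi> k k + \<pi> k M) * P(Z\<^sub>k \<ge> m)\<close>. The first factor tends to \<open>c / (c + 1)\<close>, so Toeplitz'
  lemma and induction on \<open>m\<close> give the limit \<open>(c / (c + 1)) ^ m\<close> for \<open>P(Z\<^sub>n \<ge> m)\<close>.\<close>

section \<open>Finite paths and the zero decrements along them\<close>

definition path :: "(nat \<Rightarrow> 'a \<Rightarrow> nat) \<Rightarrow> nat \<Rightarrow> 'a \<Rightarrow> nat list" where
  "path X k \<omega> = map (\<lambda>l. X l \<omega>) [0..<Suc k]"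

lemma path_0: "path X 0 \<omega> = [X 0 \<omega>]"
  by (simp add: path_def)

lemma path_Suc: "path X (Suc k) \<omega> = path X k \<omega> @ [X (Suc k) \<omega>]"
  by (simp add: path_def)

lemma length_path [simp]: "length (path X k \<omega>) = Suc k"
  by (simp add: path_def)

lemma path_eq_iff: "path X k \<omega> = ys \<longleftrightarrow> length ys = Suc k \<and> (\<forall>l\<le>k. X l \<omega> = ys ! l)"
  by (auto simp: path_def list_eq_iff_nth_eq less_Suc_eq_le simp del: upt_Suc)

lemma hd_path: "hd (path X k \<omega>) = X 0 \<omega>"
  by (simp add: path_def upt_conv_Cons del: upt_Suc)

text \<open>Defined on lists, the count does not refer to a probability space. The recursion at the
  front serves first-step analysis, while \<open>zero_steps_snoc\<close> serves growth in
  time.\<close>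

fun zero_steps :: "nat \<Rightarrow> nat list \<Rightarrow> nat" where
  "zero_steps M (x # y # xs) = (if x = y \<and> M < x then 1 else 0) + zero_steps M (y # xs)"
| "zero_steps M _ = 0"

lemma zero_steps_snoc:
  "xs \<noteq> [] \<Longrightarrow> zero_steps M (xs @ [y]) = zero_steps M xs + (if last xs = y \<and> M < y then 1 else 0)"
  by (induction M xs rule: zero_steps.induct) auto

lemma zero_steps_mono: "zero_steps M xs \<le> zero_steps M (xs @ [y])"
  by (cases "xs = []") (simp_all add: zero_steps_snoc)

lemma zero_steps_path:
  "zero_steps M (path X k \<omega>) = card {l. l < k \<and> X l \<omega> = X (Suc l) \<omega> \<and> M < X l \<omega>}"
proof (induction k)
  case 0
  then show ?case by (simp add: path_0)
next
  case (Suc k)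
  have last: "last (path X k \<omega>) = X k \<omega>" by (simp add: path_def)
  have "{l. l < Suc k \<and> X l \<omega> = X (Suc l) \<omega> \<and> M < X l \<omega>} =
      (if X k \<omega> = X (Suc k) \<omega> \<and> M < X k \<omega> then insert k else id)
        {l. l < k \<and> X l \<omega> = X (Suc l) \<omega> \<and> M < X l \<omega>}"
    by (auto simp: less_Suc_eq)
  then show ?case using Suc last length_path[of X k \<omega>]
    by (auto simp: path_Suc zero_steps_snoc simp flip: length_0_conv)
qed

section \<open>The transition kernel: path probabilities and a renewal identity\<close>

locale nonincreasing_kernel =
  fixes M :: nat and \<pi> :: "nat \<Rightarrow> nat \<Rightarrow> real"
  assumes trans: "nonincreasing_transitions M \<pi>"
begin

lemma nonneg: "M \<le> i \<Longrightarrow> M \<le> j \<Longrightarrow> 0 \<le> \<pi> i j"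
  and row_sum: "M \<le> i \<Longrightarrow> (\<Sum>j=M..i. \<pi> i j) = 1"
  and absorbing: "\<pi> M M = 1"
  and down_pos: "M < i \<Longrightarrow> 0 < \<pi> i (i - 1)"
  using trans by (auto simp: nonincreasing_transitions_def)

lemma row_split:
  assumes "M < i"
  shows "(\<Sum>j=M..i. \<pi> i j * f j) = \<pi> i i * f i + \<pi> i M * f M + (\<Sum>j\<in>{M<..<i}. \<pi> i j * f j)"
proof -
  have "{M..i} = insert i (insert M {M<..<i})" using assms by auto
  then show ?thesis using assms by simp
qed

text \<open>The positive mass at \<open>i - 1\<close> leaves less than 1 for the diagonal. This is
  what later excludes infinitely many zero decrements.\<close>

lemma diag_less_1:
  assumes "M < i"
  shows "\<pi> i i < 1"
proof -
  have "\<pi> i i + \<pi> i (i - 1) = (\<Sum>j\<in>{i - 1, i}. \<pi> i j)" using assms by simp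
  also have "\<dots> \<le> (\<Sum>j=M..i. \<pi> i j)"
    using assms by (intro sum_mono2) (auto intro: nonneg)
  finally show ?thesis using down_pos[OF assms] row_sum[of i] assms by simp
qed

text \<open>Probability of the event \<open>Q\<close> for the path of length \<open>K\<close> from \<open>i\<close>; backward recursion makes
  it comparable between chains living on different probability spaces.\<close>

fun path_prob :: "nat \<Rightarrow> nat \<Rightarrow> (nat list \<Rightarrow> bool) \<Rightarrow> real" where
  "path_prob 0 i Q = (if Q [i] then 1 else 0)"
| "path_prob (Suc K) i Q = (\<Sum>j=M..i. \<pi> i j * path_prob K j (\<lambda>xs. Q (i # xs)))"

text \<open>The probability that the chain from \<open>n\<close> visits \<open>k\<close> without any zero decrement before.\<close>

function direct_visit :: "nat \<Rightarrow> nat \<Rightarrow> real" where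
  "direct_visit n k = (if n = k then 1 else (\<Sum>j\<in>{k..<n}. \<pi> n j * direct_visit j k))"
  by auto
termination by (relation "Wellfounded.measure fst") auto

declare direct_visit.simps [simp del]

lemma direct_visit_nonneg: "M \<le> k \<Longrightarrow> 0 \<le> direct_visit n k"
proof (induction n rule: less_induct)
  case (less n)
  then show ?case
    by (subst direct_visit.simps) (auto intro!: sum_nonneg mult_nonneg_nonneg nonneg)
qed

text \<open>\<open>direct_visit\<close> is the Green kernel of the strictly decreasing part of
  \<open>\<pi>\<close> above \<open>M\<close>, so it solves every triangular system of this form.
  The induction inserts the solution for smaller states and exchanges the sums.\<close>

lemma renewal:
  assumes "\<And>n. M < n \<Longrightarrow> f n = b n + (\<Sum>j\<in>{M<..<n}. \<pi> n j * f j)"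
  shows "M < n \<Longrightarrow> f n = (\<Sum>k\<in>{M<..n}. direct_visit n k * b k)"
proof (induction n rule: less_induct)
  case (less n)
  have "(\<Sum>j\<in>{M<..<n}. \<pi> n j * f j)
      = (\<Sum>j\<in>{M<..<n}. \<Sum>k\<in>{M<..j}. \<pi> n j * direct_visit j k * b k)"
    using less.IH by (intro sum.cong) (auto simp: sum_distrib_left mult.assoc)
  also have "\<dots> = (\<Sum>j\<in>{M<..<n}. \<Sum>k | k \<in> {M<..<n} \<and> k \<le> j. \<pi> n j * direct_visit j k * b k)"
    by (intro sum.cong) auto
  also have "\<dots> = (\<Sum>k\<in>{M<..<n}. \<Sum>j | j \<in> {M<..<n} \<and> k \<le> j. \<pi> n j * direct_visit j k * b k)"
    by (rule sum.swap_restrict) auto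
  also have "\<dots> = (\<Sum>k\<in>{M<..<n}. direct_visit n k * b k)"
  proof (intro sum.cong refl)
    fix k assume k: "k \<in> {M<..<n}"
    then have "{j. j \<in> {M<..<n} \<and> k \<le> j} = {k..<n}" by auto
    then show "(\<Sum>j | j \<in> {M<..<n} \<and> k \<le> j. \<pi> n j * direct_visit j k * b k) = direct_visit n k * b k"
      using k by (simp add: direct_visit.simps[of n k] sum_distrib_right)
  qed
  \<comment> \<open>The remaining index \<open>k = n\<close> contributes \<open>b n\<close>, because
    \<open>direct_visit n n = 1\<close>.\<close>
  moreover have "{M<..n} = insert n {M<..<n}" using less.prems by auto
  ultimately show ?case
    using assms[OF less.prems] by (simp add: direct_visit.simps[of n n])
qed

end

section \<open>The law of the paths of a single chain\<close>

locale nonincreasing_chain = nonincreasing_kernel M \<pi> + prob_space P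
  for M \<pi> and P :: "'a measure" +
  fixes n :: nat and X :: "nat \<Rightarrow> 'a \<Rightarrow> nat"
  assumes chain: "nonincreasing_chain_from M \<pi> n P X" and start: "M \<le> n"
begin

lemma measurable_X [measurable]: "X k \<in> measurable P (count_space UNIV)"
proof -
  have "X k \<in> measurable P (count_space {M..})"
    using chain by (simp add: nonincreasing_chain_from_def markov_chain_def)
  then show ?thesis by (rule measurable_compose) simp
qed

lemma X_ge: "\<omega> \<in> space P \<Longrightarrow> M \<le> X k \<omega>"
  using chain
  by (auto simp: nonincreasing_chain_from_def markov_chain_def dest!: spec[of _ k] measurable_space)

lemma X_0: "AE \<omega> in P. X 0 \<omega> = n"
  using chain by (simp add: nonincreasing_chain_from_def)

lemma pred_zero_step: "Measurable.pred P (\<lambda>\<omega>. X k \<omega> = X (Suc k) \<omega> \<and> M < X k \<omega>)"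
proof -
  have 1: "Measurable.pred P (\<lambda>\<omega>. X k \<omega> = X (Suc k) \<omega>)"
    by (rule measurable_compose_countable[OF _ measurable_X[of k]]) measurable
  have "Measurable.pred P (\<lambda>\<omega>. M < X k \<omega>)"
    by (rule measurable_compose[OF measurable_X]) simp
  with 1 show ?thesis by (rule pred_intros_logic)
qed

lemma measurable_path [measurable]: "path X k \<in> measurable P (count_space UNIV)"
proof (induction k)
  case 0
  show ?case by (simp add: path_0[abs_def])
next
  case (Suc k)
  have "(\<lambda>\<omega>. path X k \<omega> @ [X (Suc k) \<omega>]) \<in> measurable P (count_space UNIV)"
    by (rule measurable_compose_countable[OF _ Suc]) measurable
  then show ?case by (simp add: path_Suc[abs_def])
qed

text \<open>The Markov property in product form. For a null history both sides vanish, so the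
  conditional clauses of \<open>markov_chain\<close> are invoked only where they constrain
  anything.\<close>

lemma prob_path_snoc:
  assumes ys: "length ys = Suc k" and j: "M \<le> j"
  shows "\<P>(\<omega> in P. path X (Suc k) \<omega> = ys @ [j]) = \<P>(\<omega> in P. path X k \<omega> = ys) * \<pi> (last ys) j"
proof (cases "\<P>(\<omega> in P. path X k \<omega> = ys) = 0")
  case True
  have "\<P>(\<omega> in P. path X (Suc k) \<omega> = ys @ [j]) \<le> \<P>(\<omega> in P. path X k \<omega> = ys)"
    by (rule finite_measure_mono) (auto simp: path_Suc)
  then show ?thesis using True by (simp add: measure_le_0_iff)
next
  case False
  let ?x = "\<lambda>l. ys ! l"
  have ev: "{\<omega> \<in> space P. path X k \<omega> = ys} = {\<omega> \<in> space P. \<forall>l\<le>k. X l \<omega> = ?x l}"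
    using ys by (simp add: path_eq_iff)
  have pos: "\<P>(\<omega> in P. \<forall>l\<le>k. X l \<omega> = ?x l) > 0"
    using False by (simp add: ev zero_less_measure_iff)
  \<comment> \<open>A sample point realizing the history shows that all its states lie in
    \<open>{M..}\<close>.\<close>
  then have "{\<omega> \<in> space P. \<forall>l\<le>k. X l \<omega> = ?x l} \<noteq> {}"
    by (metis less_irrefl measure_empty)
  then obtain \<omega> where "\<omega> \<in> space P" "\<forall>l\<le>k. X l \<omega> = ?x l" by auto
  then have ge: "\<forall>l\<le>k. ?x l \<in> {M..}" using X_ge by (metis atLeast_iff)
  have "\<P>(\<omega> in P. \<forall>l\<le>k. X l \<omega> = ?x l) \<le> \<P>(\<omega> in P. X k \<omega> = ?x k)"
    by (rule finite_measure_mono) auto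
  with pos have pos': "\<P>(\<omega> in P. X k \<omega> = ?x k) > 0" by simp
  have mc: "markov_chain {M..} \<pi> P X"
    using chain by (simp add: nonincreasing_chain_from_def)
  have "\<P>(\<omega> in P. X (Suc k) \<omega> = j \<bar> \<forall>l\<le>k. X l \<omega> = ?x l)
      = \<P>(\<omega> in P. X (Suc k) \<omega> = j \<bar> X k \<omega> = ?x k)"
    by (rule mc[unfolded markov_chain_def, THEN conjunct2, THEN conjunct2, THEN conjunct2, rule_format])
      (use j pos ge in auto)
  also have "\<dots> = \<pi> (?x k) j"
    using mc j pos' ge unfolding markov_chain_def by auto
  also have "?x k = last ys" using ys by (metis diff_Suc_1 last_conv_nth length_0_conv nat.distinct(1))
  finally have "\<P>(\<omega> in P. X (Suc k) \<omega> = j \<and> (\<forall>l\<le>k. X l \<omega> = ?x l))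
      = \<P>(\<omega> in P. \<forall>l\<le>k. X l \<omega> = ?x l) * \<pi> (last ys) j"
    using pos by (simp add: cond_prob_def field_simps)
  moreover have "{\<omega> \<in> space P. path X (Suc k) \<omega> = ys @ [j]}
      = {\<omega> \<in> space P. X (Suc k) \<omega> = j \<and> (\<forall>l\<le>k. X l \<omega> = ?x l)}"
    using ys by (auto simp: path_Suc path_eq_iff)
  ultimately show ?thesis by (simp add: ev)
qed

text \<open>Induction on \<open>K\<close> splits the event by the state that follows
  \<open>ys\<close>. Only \<open>butlast ys\<close> is prepended, since the lists fed to
  \<open>Q\<close> by \<open>path_prob\<close> already begin with \<open>last ys\<close>.\<close>

lemma prob_path_prefix:
  "length ys = Suc k \<Longrightarrow>
    \<P>(\<omega> in P. path X k \<omega> = ys \<and> Q (path X (k + K) \<omega>))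
    = \<P>(\<omega> in P. path X k \<omega> = ys) * path_prob K (last ys) (\<lambda>xs. Q (butlast ys @ xs))"
proof (induction K arbitrary: k ys)
  case 0
  then have "ys \<noteq> []" by auto
  then show ?case by (cases "Q ys") (auto simp: conj_commute cong: conj_cong)
next
  case (Suc K)
  let ?i = "last ys" and ?p = "\<P>(\<omega> in P. path X k \<omega> = ys)"
  define E where "E j = {\<omega> \<in> space P. path X (Suc k) \<omega> = ys @ [j]}" for j
  define F where "F = {\<omega> \<in> space P. path X k \<omega> = ys}"
  define G where "G = {\<omega> \<in> space P. Q (path X (k + Suc K) \<omega>)}"
  have [measurable]: "E j \<in> events" for j unfolding E_def by measurable
  have [measurable]: "F \<in> events" unfolding F_def by measurable
  have [measurable]: "G \<in> events" unfolding G_def by measurable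
  have sub: "(\<Union>j\<in>{M..?i}. E j) \<subseteq> F" by (auto simp: E_def F_def path_Suc)
  have disj: "disjoint_family_on E {M..?i}" by (auto simp: disjoint_family_on_def E_def)
  have E: "prob (E j) = ?p * \<pi> ?i j" if "j \<in> {M..?i}" for j
    using prob_path_snoc[OF Suc.prems, of j] that by (simp add: E_def)
  \<comment> \<open>Unless \<open>F\<close> itself is null, the masses of the \<open>E j\<close>
    already add up to that of \<open>F\<close>, as the row of \<open>?i\<close> sums to 1.\<close>
  have null: "prob (F - (\<Union>j\<in>{M..?i}. E j)) = 0"
  proof (cases "?p = 0")
    case True
    have "prob (F - (\<Union>j\<in>{M..?i}. E j)) \<le> prob F" by (rule finite_measure_mono) auto
    then show ?thesis using True by (simp add: F_def measure_le_0_iff)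
  next
    case False
    then have "{\<omega> \<in> space P. path X k \<omega> = ys} \<noteq> {}" by (metis measure_empty)
    then obtain \<omega> where "\<omega> \<in> space P" "path X k \<omega> = ys" by auto
    moreover have "last (path X k \<omega>) = X k \<omega>" by (simp add: path_def)
    ultimately have "M \<le> ?i" using X_ge by metis
    have "prob (F - (\<Union>j\<in>{M..?i}. E j)) = prob F - prob (\<Union>j\<in>{M..?i}. E j)"
      using sub by (intro finite_measure_Diff) auto
    also have "prob (\<Union>j\<in>{M..?i}. E j) = (\<Sum>j=M..?i. ?p * \<pi> ?i j)"
      using disj E by (subst finite_measure_finite_Union) auto
    finally show ?thesis using row_sum[OF \<open>M \<le> ?i\<close>] by (simp add: F_def flip: sum_distrib_left)
  qed
  have "prob (F \<inter> G) \<le> prob ((\<Union>j\<in>{M..?i}. E j \<inter> G) \<union> (F - (\<Union>j\<in>{M..?i}. E j)))"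
    by (rule finite_measure_mono) auto
  also have "\<dots> \<le> prob (\<Union>j\<in>{M..?i}. E j \<inter> G) + prob (F - (\<Union>j\<in>{M..?i}. E j))"
    by (rule measure_Un_le) auto
  finally have "prob (F \<inter> G) \<le> prob (\<Union>j\<in>{M..?i}. E j \<inter> G)" using null by simp
  moreover have "prob (\<Union>j\<in>{M..?i}. E j \<inter> G) \<le> prob (F \<inter> G)"
    using sub by (intro finite_measure_mono) auto
  ultimately have "prob (F \<inter> G) = prob (\<Union>j\<in>{M..?i}. E j \<inter> G)" by simp
  also have "\<dots> = (\<Sum>j=M..?i. prob (E j \<inter> G))"
    using disj by (intro finite_measure_finite_Union) (auto simp: disjoint_family_on_def)
  also have "\<dots> = (\<Sum>j=M..?i. prob (E j) * path_prob K j (\<lambda>xs. Q (ys @ xs)))"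
  proof (intro sum.cong refl)
    fix j
    have "E j \<inter> G = {\<omega> \<in> space P. path X (Suc k) \<omega> = ys @ [j] \<and> Q (path X (Suc k + K) \<omega>)}"
      by (auto simp: E_def G_def)
    then show "prob (E j \<inter> G) = prob (E j) * path_prob K j (\<lambda>xs. Q (ys @ xs))"
      using Suc.IH[of "ys @ [j]" "Suc k"] Suc.prems by (simp add: E_def)
  qed
  also have "\<dots> = ?p * path_prob (Suc K) ?i (\<lambda>xs. Q (butlast ys @ xs))"
  proof -
    have "ys \<noteq> []" using Suc.prems by auto
    then have *: "butlast ys @ last ys # xs = ys @ xs" for xs
      by (metis append_butlast_last_id append.assoc append_Cons append_Nil)
    show ?thesis by (simp add: E * sum_distrib_left mult.assoc)
  qed
  finally show ?case by (simp add: F_def G_def Int_def conj_ac cong: conj_cong)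
qed

text \<open>The prefix \<open>[n]\<close> has probability 1. Hence path laws depend only on the
  kernel and the start, which relates chains on different probability spaces.\<close>

lemma prob_path: "\<P>(\<omega> in P. Q (path X K \<omega>)) = path_prob K n Q"
proof -
  have 1: "\<P>(\<omega> in P. path X 0 \<omega> = [n]) = 1"
    using X_0 by (subst prob_Collect_eq_1) (auto simp: path_0)
  have "\<P>(\<omega> in P. Q (path X K \<omega>)) = \<P>(\<omega> in P. path X 0 \<omega> = [n] \<and> Q (path X (0 + K) \<omega>))"
    using X_0 by (intro finite_measure_eq_AE) (auto simp: path_0)
  also have "\<dots> = path_prob K n Q" using 1 by (subst prob_path_prefix) auto
  finally show ?thesis .
qed

text \<open>Continuity from below: a property that persists under extension yields increasing
  events.\<close>

lemma path_prob_tendsto: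
  assumes Q: "\<And>xs y. Q xs \<Longrightarrow> Q (xs @ [y])"
  shows "(\<lambda>K. path_prob K n Q) \<longlonglongrightarrow> \<P>(\<omega> in P. \<exists>K. Q (path X K \<omega>))"
proof -
  let ?A = "\<lambda>K. {\<omega> \<in> space P. Q (path X K \<omega>)}"
  have "(\<lambda>K. prob (?A K)) \<longlonglongrightarrow> prob (\<Union>K. ?A K)"
    using Q by (intro finite_Lim_measure_incseq incseq_SucI) (auto simp: path_Suc)
  moreover have "(\<Union>K. ?A K) = {\<omega> \<in> space P. \<exists>K. Q (path X K \<omega>)}" by auto
  ultimately show ?thesis by (simp add: prob_path)
qed

end

section \<open>First-step analysis across the family of chains\<close>

locale nonincreasing_family = nonincreasing_kernel M \<pi>
  for M \<pi> +
  fixes P :: "nat \<Rightarrow> 'a measure" and I :: "nat \<Rightarrow> nat \<Rightarrow> 'a \<Rightarrow> nat"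
  assumes chains: "M \<le> n \<Longrightarrow> nonincreasing_chain_from M \<pi> n (P n) (I n)"
begin

lemma chain_at: "M \<le> n \<Longrightarrow> nonincreasing_chain M \<pi> (P n) n (I n)"
  using chains[of n] nonincreasing_kernel_axioms
  unfolding nonincreasing_chain_def nonincreasing_chain_axioms_def
  by (simp add: nonincreasing_chain_from_def markov_chain_def)

definition ev_prob :: "nat \<Rightarrow> (nat list \<Rightarrow> bool) \<Rightarrow> real" where
  "ev_prob n Q = \<P>(\<omega> in P n. \<exists>K. Q (path (I n) K \<omega>))"

lemma ev_prob_tendsto:
  assumes "M \<le> n" "\<And>xs y. Q xs \<Longrightarrow> Q (xs @ [y])"
  shows "(\<lambda>K. path_prob K n Q) \<longlonglongrightarrow> ev_prob n Q"
  unfolding ev_prob_def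
  using nonincreasing_chain.path_prob_tendsto[OF chain_at] assms by blast

text \<open>Obtained by letting \<open>K\<close> grow in the backward recursion of
  \<open>path_prob\<close>, so no shifted chain has to be constructed.\<close>

lemma ev_prob_first_step:
  assumes n: "M \<le> n" and Q: "\<And>xs y. Q xs \<Longrightarrow> Q (xs @ [y])"
  shows "ev_prob n Q = (\<Sum>j=M..n. \<pi> n j * ev_prob j (\<lambda>xs. Q (n # xs)))"
proof (rule LIMSEQ_unique)
  show "(\<lambda>K. path_prob (Suc K) n Q) \<longlonglongrightarrow> ev_prob n Q"
    by (rule LIMSEQ_Suc) (rule ev_prob_tendsto[of n Q, OF n Q])
  have "Q (n # xs @ [y])" if "Q (n # xs)" for xs y
    using Q[OF that, of y] by simp
  then show "(\<lambda>K. path_prob (Suc K) n Q)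
      \<longlonglongrightarrow> (\<Sum>j=M..n. \<pi> n j * ev_prob j (\<lambda>xs. Q (n # xs)))"
    unfolding path_prob.simps by (intro tendsto_sum tendsto_mult tendsto_const ev_prob_tendsto) auto
qed

text \<open>Almost every path starts in \<open>n\<close>, so \<open>Q\<close> matters only on lists
  with that head. This simplifies the events \<open>Q (n # xs)\<close> produced by a first
  step.\<close>

lemma ev_prob_cong:
  assumes n: "M \<le> n" and "\<And>xs. xs \<noteq> [] \<Longrightarrow> hd xs = n \<Longrightarrow> Q xs \<longleftrightarrow> Q' xs"
  shows "ev_prob n Q = ev_prob n Q'"
proof -
  interpret nonincreasing_chain M \<pi> "P n" n "I n" by (rule chain_at[OF n])
  have *: "Q (path (I n) K \<omega>) \<longleftrightarrow> Q' (path (I n) K \<omega>)" if "I n 0 \<omega> = n" for K \<omega>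
    using that by (intro assms(2)) (auto simp: hd_path simp flip: length_0_conv)
  show ?thesis unfolding ev_prob_def
    using X_0 * by (intro finite_measure_eq_AE) auto
qed

text \<open>Plays the role of \<open>P(Z\<^sub>n \<ge> m)\<close>. Formulated through finite paths,
  it needs no finiteness of the set of zero decrements.\<close>

definition tail :: "nat \<Rightarrow> nat \<Rightarrow> real" where
  "tail n m = ev_prob n (\<lambda>xs. m \<le> zero_steps M xs)"

lemma tail_0 [simp]:
  assumes "M \<le> n"
  shows "tail n 0 = 1"
proof -
  interpret nonincreasing_chain M \<pi> "P n" n "I n" by (rule chain_at[OF assms])
  show ?thesis by (simp add: tail_def ev_prob_def prob_space)
qed

text \<open>The path from \<open>M\<close> stays there, and repetitions of \<open>M\<close> are not
  counted.\<close>

lemma tail_absorbed [simp]: "tail M (Suc m) = 0"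
proof (rule LIMSEQ_unique)
  show "(\<lambda>K. path_prob K M (\<lambda>xs. Suc m \<le> zero_steps M xs)) \<longlonglongrightarrow> tail M (Suc m)"
    unfolding tail_def by (rule ev_prob_tendsto) (auto intro: order_trans[OF _ zero_steps_mono])
  have "path_prob K M Q = (if Q (replicate (Suc K) M) then 1 else 0)" for K Q
    by (induction K arbitrary: Q) (simp_all add: absorbing)
  moreover have "zero_steps M (replicate (Suc K) M) = 0" for K
    by (induction K) auto
  ultimately show "(\<lambda>K. path_prob K M (\<lambda>xs. Suc m \<le> zero_steps M xs)) \<longlonglongrightarrow> 0"
    by (simp del: replicate_Suc)
qed

text \<open>A first step back to \<open>n\<close> uses up one zero decrement, and a step to
  \<open>M\<close> ends the count. The result has the form solved by \<open>renewal\<close>.\<close>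

lemma tail_Suc:
  assumes "M < n"
  shows "tail n (Suc m) = \<pi> n n * tail n m + (\<Sum>j\<in>{M<..<n}. \<pi> n j * tail j (Suc m))"
proof -
  define f where "f j = ev_prob j (\<lambda>xs. Suc m \<le> zero_steps M (n # xs))" for j
  have "tail n (Suc m) = (\<Sum>j=M..n. \<pi> n j * f j)"
    unfolding tail_def f_def using assms
    by (intro ev_prob_first_step) (auto intro: order_trans[OF _ zero_steps_mono])
  moreover have "f j = (if j = n then tail n m else tail j (Suc m))" if "M \<le> j" for j
    unfolding f_def tail_def if_distrib[of "ev_prob _"]
  proof -
    have "zero_steps M (n # xs) = zero_steps M xs + (if j = n then 1 else 0)"
      if "xs \<noteq> []" "hd xs = j" for xs
      using that assms by (cases xs) auto
    then show "ev_prob j (\<lambda>xs. Suc m \<le> zero_steps M (n # xs)) =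
        (if j = n then ev_prob n (\<lambda>xs. m \<le> zero_steps M xs)
         else ev_prob j (\<lambda>xs. Suc m \<le> zero_steps M xs))"
      using \<open>M \<le> j\<close> by (auto intro!: ev_prob_cong)
  qed
  ultimately show ?thesis using assms by (simp add: row_split)
qed

lemma tail_bounds:
  assumes "M \<le> n"
  shows "0 \<le> tail n m" "tail n (Suc m) \<le> tail n m"
proof -
  interpret nonincreasing_chain M \<pi> "P n" n "I n" by (rule chain_at[OF assms])
  show "0 \<le> tail n m" by (auto simp: tail_def ev_prob_def)
  show "tail n (Suc m) \<le> tail n m"
    unfolding tail_def ev_prob_def by (rule finite_measure_mono) (auto intro: Suc_leD)
qed

text \<open>Expresses that almost surely only finitely many zero decrements occur. By monotonicity a
  limit \<open>L\<close> exists; smaller states contribute 0 by induction, leaving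
  \<open>L = \<pi> n n * L\<close> with \<open>\<pi> n n < 1\<close>.\<close>

lemma tail_tendsto_0: "M \<le> n \<Longrightarrow> (\<lambda>m. tail n m) \<longlonglongrightarrow> 0"
proof (induction n rule: less_induct)
  case (less n)
  show ?case
  proof (cases "n = M")
    case True
    \<comment> \<open>The shift is needed because \<open>tail M 0 = 1\<close>; only the later terms
      vanish.\<close>
    then show ?thesis by (intro LIMSEQ_imp_Suc[where f = "\<lambda>m. tail n m"]) simp
  next
    case False
    then have n: "M < n" using less.prems by simp
    have "decseq (tail n)" using less.prems by (intro decseq_SucI tail_bounds)
    then obtain L where L: "(\<lambda>m. tail n m) \<longlonglongrightarrow> L"
      by (rule decseq_convergent[where B = 0]) (use tail_bounds less.prems in auto)
    have "(\<lambda>m. tail n (Suc m)) \<longlonglongrightarrow> \<pi> n n * L + (\<Sum>j\<in>{M<..<n}. \<pi> n j * 0)"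
      unfolding tail_Suc[OF n]
    proof (intro tendsto_add tendsto_mult tendsto_const tendsto_sum L)
      fix j assume "j \<in> {M<..<n}"
      then have "(\<lambda>m. tail j m) \<longlonglongrightarrow> 0" using less.IH by simp
      then show "(\<lambda>m. tail j (Suc m)) \<longlonglongrightarrow> 0" by (rule LIMSEQ_Suc)
    qed
    from LIMSEQ_unique[OF LIMSEQ_Suc[OF L] this] have "L = \<pi> n n * L" by simp
    then have "L = 0" using diag_less_1[OF n] by simp
    then show ?thesis using L by simp
  qed
qed

lemma visit_prob_eq: "visit_prob (P n) (I n) k = ev_prob n (\<lambda>xs. k \<in> set xs)"
proof -
  have "(\<exists>m. I n m \<omega> = k) \<longleftrightarrow> (\<exists>K. k \<in> set (path (I n) K \<omega>))" for \<omega>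
    unfolding path_def by (auto simp del: upt_Suc) (metis atLeastLessThan_iff imageI le0 lessI)
  then show ?thesis by (simp add: visit_prob_def ev_prob_def)
qed

text \<open>Both sides obey a first-step recursion, and the one for visits has additional
  nonnegative terms, notably the zero step \<open>j = n\<close>.\<close>

lemma direct_visit_le: "M < k \<Longrightarrow> M \<le> n \<Longrightarrow> direct_visit n k \<le> visit_prob (P n) (I n) k"
proof (induction n rule: less_induct)
  case (less n)
  have nn: "0 \<le> visit_prob (P j) (I j) k" for j by (simp add: visit_prob_def)
  show ?case
  proof (cases "n = k")
    case True
    interpret nonincreasing_chain M \<pi> "P n" n "I n" by (rule chain_at) fact
    have "visit_prob (P n) (I n) k = 1"
      unfolding visit_prob_def using X_0 True by (subst prob_Collect_eq_1) (measurable, auto)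
    then show ?thesis using True by (simp add: direct_visit.simps)
  next
    case False
    have "direct_visit n k = (\<Sum>j\<in>{k..<n}. \<pi> n j * direct_visit j k)"
      using False by (subst direct_visit.simps) simp
    also have "\<dots> \<le> (\<Sum>j\<in>{k..<n}. \<pi> n j * visit_prob (P j) (I j) k)"
      using less by (intro sum_mono mult_left_mono nonneg) auto
    also have "\<dots> \<le> (\<Sum>j=M..n. \<pi> n j * visit_prob (P j) (I j) k)"
      using less.prems nn by (intro sum_mono2 mult_nonneg_nonneg nonneg) auto
    also have "\<dots> = visit_prob (P n) (I n) k"
      unfolding visit_prob_eq
      using False less.prems by (subst ev_prob_first_step[of n]) auto
    finally show ?thesis .
  qed
qed

text \<open>For finite \<open>S \<omega>\<close> the two events agree. An infinite
  \<open>S \<omega>\<close>, where \<open>card\<close> returns 0, satisfies every tail event, so it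
  has probability at most \<open>tail n m\<close> for all \<open>m\<close>, hence 0.\<close>

lemma prob_zero_decrements:
  assumes n: "M \<le> n"
  shows "zero_decrements M (I n) \<in> measurable (P n) (count_space UNIV)"
    and "\<P>(\<omega> in P n. m \<le> zero_decrements M (I n) \<omega>) = tail n m"
proof -
  interpret nonincreasing_chain M \<pi> "P n" n "I n" by (rule chain_at[OF n])
  define S where "S \<omega> = {k. I n k \<omega> = I n (Suc k) \<omega> \<and> M < I n k \<omega>}" for \<omega>
  have Z: "zero_decrements M (I n) \<omega> = card (S \<omega>)" for \<omega>
    by (simp add: zero_decrements_def S_def)
  have steps: "zero_steps M (path (I n) K \<omega>) = card (S \<omega> \<inter> {..<K})" for K \<omega>
    unfolding zero_steps_path S_def by (rule arg_cong[where f = card]) auto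
  have S [measurable]: "Measurable.pred (P n) (\<lambda>\<omega>. k \<in> S \<omega>)" for k
    unfolding S_def mem_Collect_eq by (rule pred_zero_step)
  have [measurable]: "Measurable.pred (P n) (\<lambda>\<omega>. finite (S \<omega>))"
    by (rule measurable_finite) (use S in simp)
  have finD: "m \<le> card (S \<omega>) \<longleftrightarrow> (\<exists>K. m \<le> zero_steps M (path (I n) K \<omega>))"
    if fin: "finite (S \<omega>)" for \<omega> m
  proof -
    obtain K where "S \<omega> \<subseteq> {..<K}" using fin finite_nat_iff_bounded by blast
    then have "zero_steps M (path (I n) K \<omega>) = card (S \<omega>)" by (simp add: steps Int_absorb2)
    moreover have "zero_steps M (path (I n) K \<omega>) \<le> card (S \<omega>)" for K
      unfolding steps using fin by (intro card_mono) auto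
    ultimately show ?thesis using order_trans by (intro iffI exI[of _ K]) (simp, blast)
  qed
  have infD: "\<exists>K. m \<le> zero_steps M (path (I n) K \<omega>)" if inf: "infinite (S \<omega>)" for \<omega> m
  proof -
    obtain A where A: "A \<subseteq> S \<omega>" "finite A" "card A = m"
      using infinite_arbitrarily_large[OF inf] by blast
    then obtain K where "A \<subseteq> {..<K}" using finite_nat_iff_bounded by blast
    then have "card A \<le> card (S \<omega> \<inter> {..<K})" using A by (intro card_mono) auto
    then have "m \<le> zero_steps M (path (I n) K \<omega>)" using A by (simp add: steps)
    then show ?thesis by blast
  qed
  have [measurable]: "(\<lambda>\<omega>. card (S \<omega>)) \<in> measurable (P n) (count_space UNIV)"
    by (rule measurable_card) (use S in \<open>simp add: pred_def\<close>)
  then show "zero_decrements M (I n) \<in> measurable (P n) (count_space UNIV)"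
    by (simp add: Z[abs_def])
  have "prob {\<omega> \<in> space (P n). infinite (S \<omega>)} \<le> tail n m" for m
    unfolding tail_def ev_prob_def using infD by (intro finite_measure_mono) auto
  then have "prob {\<omega> \<in> space (P n). infinite (S \<omega>)} \<le> 0"
    using tail_tendsto_0[OF n] by (intro LIMSEQ_le_const) auto
  then have "prob {\<omega> \<in> space (P n). infinite (S \<omega>)} = 0"
    by (simp add: measure_le_0_iff)
  then have "AE \<omega> in P n. finite (S \<omega>)"
    by (subst (asm) prob_eq_0) auto
  then show "\<P>(\<omega> in P n. m \<le> zero_decrements M (I n) \<omega>) = tail n m"
    unfolding tail_def ev_prob_def Z
    using finD by (intro finite_measure_eq_AE) auto
qed

end

section \<open>Toeplitz averaging\<close>

text \<open>The finitely many indices below \<open>N\<close> lose their weight as \<open>n\<close>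
  grows, and the others average values within \<open>e / 2\<close> of \<open>L\<close>.\<close>

lemma toeplitz:
  fixes w :: "nat \<Rightarrow> nat \<Rightarrow> real" and a :: "nat \<Rightarrow> real"
  assumes nonneg: "\<And>n k. M < k \<Longrightarrow> k \<le> n \<Longrightarrow> 0 \<le> w n k"
    and sum1: "\<And>n. M < n \<Longrightarrow> (\<Sum>k\<in>{M<..n}. w n k) = 1"
    and w0: "\<And>k. M < k \<Longrightarrow> (\<lambda>n. w n k) \<longlonglongrightarrow> 0"
    and a: "a \<longlonglongrightarrow> L"
  shows "(\<lambda>n. \<Sum>k\<in>{M<..n}. w n k * a k) \<longlonglongrightarrow> L"
proof (rule LIMSEQ_I)
  fix e :: real assume e: "0 < e"
  obtain N where N: "\<And>k. N \<le> k \<Longrightarrow> \<bar>a k - L\<bar> < e / 2"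
    using LIMSEQ_D[OF a, of "e / 2"] e by auto
  have "(\<lambda>n. \<Sum>k\<in>{M<..<N}. w n k * \<bar>a k - L\<bar>) \<longlonglongrightarrow> (\<Sum>k\<in>{M<..<N}. 0 * \<bar>a k - L\<bar>)"
    using w0 by (intro tendsto_sum tendsto_mult tendsto_const) auto
  then have "(\<lambda>n. \<Sum>k\<in>{M<..<N}. w n k * \<bar>a k - L\<bar>) \<longlonglongrightarrow> 0" by simp
  then have "\<forall>\<^sub>F n in sequentially. (\<Sum>k\<in>{M<..<N}. w n k * \<bar>a k - L\<bar>) < e / 2"
    using e by (intro order_tendstoD) auto
  then obtain N' where N': "\<And>n. N' \<le> n \<Longrightarrow> (\<Sum>k\<in>{M<..<N}. w n k * \<bar>a k - L\<bar>) < e / 2"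
    by (auto simp: eventually_sequentially)
  show "\<exists>no. \<forall>n\<ge>no. norm ((\<Sum>k\<in>{M<..n}. w n k * a k) - L) < e"
  proof (intro exI allI impI)
    fix n assume "max N' (max N (Suc M)) \<le> n"
    then have n: "N' \<le> n" "N \<le> n" "M < n" by auto
    have "(\<Sum>k\<in>{M<..n}. w n k * a k) - L = (\<Sum>k\<in>{M<..n}. w n k * (a k - L))"
      using sum1[OF n(3)] by (simp add: algebra_simps sum_subtractf flip: sum_distrib_left)
    also have "norm \<dots> \<le> (\<Sum>k\<in>{M<..n}. w n k * \<bar>a k - L\<bar>)"
      by (rule order_trans[OF norm_sum])
        (intro sum_mono, auto simp: abs_mult nonneg abs_of_nonneg)
    \<comment> \<open>Adding \<open>e / 2\<close> at every index, not only from \<open>N\<close> on,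
      lets the total weight 1 be used directly.\<close>
    also have "\<dots> \<le> (\<Sum>k\<in>{M<..n}. (if k < N then w n k * \<bar>a k - L\<bar> else 0) + w n k * (e / 2))"
    proof (rule sum_mono)
      fix k assume k: "k \<in> {M<..n}"
      then have "0 \<le> w n k" by (simp add: nonneg)
      then show "w n k * \<bar>a k - L\<bar> \<le> (if k < N then w n k * \<bar>a k - L\<bar> else 0) + w n k * (e / 2)"
        using N[of k] e mult_left_mono[of "\<bar>a k - L\<bar>" "e / 2" "w n k"] by (cases "k < N") auto
    qed
    also have "\<dots> = (\<Sum>k\<in>{M<..<N}. w n k * \<bar>a k - L\<bar>) + e / 2"
    proof -
      have "{k \<in> {M<..n}. k < N} = {M<..<N}" using n by auto
      then show ?thesis
        using sum1[OF n(3)]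
        by (simp add: sum.distrib flip: sum.inter_filter sum_distrib_right sum_divide_distrib)
    qed
    also have "\<dots> < e" using N'[OF n(1)] by simp
    finally show "norm ((\<Sum>k\<in>{M<..n}. w n k * a k) - L) < e" .
  qed
qed

section \<open>The limit of the tail probabilities\<close>

context nonincreasing_family
begin

lemma tail_limit:
  assumes g: "\<And>k. k \<ge> M + 1 \<Longrightarrow> (\<lambda>n. visit_prob (P n) (I n) k) \<longlonglongrightarrow> 0"
    and ratio: "(\<lambda>n. \<pi> n n / \<pi> n M) \<longlonglongrightarrow> c"
    and c: "c > 0"
  shows "(\<lambda>n. tail n m) \<longlonglongrightarrow> (c / (c + 1)) ^ m"
proof (induction m)
  case 0
  show ?case
    by (rule tendsto_eventually) (auto simp: eventually_sequentially intro!: exI[of _ M])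
next
  case (Suc m)
  define b where "b k = \<pi> k k + \<pi> k M" for k
  define w where "w n k = direct_visit n k * b k" for n k
  define a where "a k = \<pi> k k / b k * tail k m" for k
  have b_nonneg: "0 \<le> b k" if "M < k" for k
    using that by (simp add: b_def nonneg)
  \<comment> \<open>If \<open>b k = 0\<close>, nonnegativity gives \<open>\<pi> k k = 0\<close>, so
    both sides are 0 and the division in \<open>a\<close> does no harm.\<close>
  have w_a: "w n k * a k = direct_visit n k * (\<pi> k k * tail k m)" if "M < k" for n k
    using nonneg[of k k] nonneg[of k M] that
    by (cases "b k = 0") (auto simp: w_def a_def b_def add_nonneg_eq_0_iff)
  have "(\<lambda>n. \<Sum>k\<in>{M<..n}. w n k * a k) \<longlonglongrightarrow> c / (c + 1) * (c / (c + 1)) ^ m"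
  proof (rule toeplitz)
    show "0 \<le> w n k" if "M < k" for n k
      using that b_nonneg by (simp add: w_def direct_visit_nonneg)
    \<comment> \<open>The constant function 1 solves the renewal equation with source
      \<open>b\<close>, so the weights sum to 1.\<close>
    have "1 = b n + (\<Sum>j\<in>{M<..<n}. \<pi> n j * 1)" if "M < n" for n
      using row_split[OF that, of "\<lambda>_. 1"] row_sum[of n] that by (simp add: b_def)
    then show "(\<Sum>k\<in>{M<..n}. w n k) = 1" if "M < n" for n
      unfolding w_def using renewal[of "\<lambda>_. 1" b, OF _ that] by simp
    show "(\<lambda>n. w n k) \<longlonglongrightarrow> 0" if k: "M < k" for k
    proof -
      have "(\<lambda>n. direct_visit n k) \<longlonglongrightarrow> 0"
      proof (rule tendsto_sandwich[OF _ _ tendsto_const g])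
        show "\<forall>\<^sub>F n in sequentially. direct_visit n k \<le> visit_prob (P n) (I n) k"
          using k direct_visit_le by (auto simp: eventually_sequentially)
      qed (use k in \<open>auto simp: direct_visit_nonneg\<close>)
      then show ?thesis unfolding w_def by (rule tendsto_mult_left_zero)
    qed
    \<comment> \<open>Division by zero yields 0, so a positive quotient guarantees
      \<open>\<pi> n M \<noteq> 0\<close>.\<close>
    have "\<forall>\<^sub>F n in sequentially. 0 < \<pi> n n / \<pi> n M"
      using ratio c by (rule order_tendstoD)
    then have "\<forall>\<^sub>F n in sequentially. \<pi> n n / \<pi> n M / (\<pi> n n / \<pi> n M + 1) = \<pi> n n / b n"
    proof eventually_elim
      case (elim n)
      then have "\<pi> n M \<noteq> 0" by auto
      then show ?case by (simp add: b_def add_divide_distrib[symmetric] divide_simps)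
    qed
    moreover have "(\<lambda>n. \<pi> n n / \<pi> n M / (\<pi> n n / \<pi> n M + 1)) \<longlonglongrightarrow> c / (c + 1)"
      using ratio c by (intro tendsto_intros) auto
    ultimately have "(\<lambda>n. \<pi> n n / b n) \<longlonglongrightarrow> c / (c + 1)"
      by (rule Lim_transform_eventually[rotated])
    then show "a \<longlonglongrightarrow> c / (c + 1) * (c / (c + 1)) ^ m"
      unfolding a_def using Suc.IH by (rule tendsto_mult)
  qed
  \<comment> \<open>By \<open>tail_Suc\<close>, the tails solve the renewal equation with source
    \<open>\<pi> n n * tail n m\<close>.\<close>
  moreover have "tail n (Suc m) = (\<Sum>k\<in>{M<..n}. w n k * a k)" if "M < n" for n
    using renewal[of "\<lambda>n. tail n (Suc m)" "\<lambda>n. \<pi> n n * tail n m", OF tail_Suc that] w_a by simp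
  then have "\<forall>\<^sub>F n in sequentially. (\<Sum>k\<in>{M<..n}. w n k * a k) = tail n (Suc m)"
    by (auto simp: eventually_sequentially intro!: exI[of _ "Suc M"])
  ultimately show ?case by (auto intro: Lim_transform_eventually)
qed

end

section \<open>The geometric law and convergence of distribution functions\<close>

lemma prob_geometric_ge:
  assumes "0 < p" "p \<le> 1"
  shows "\<P>(i in geometric_pmf p. m \<le> i) = (1 - p) ^ m"
proof -
  have "\<P>(i in geometric_pmf p. m \<le> i) = measure_pmf.prob (geometric_pmf p) (- {..<m})"
    by (auto intro!: arg_cong[where f = "measure _"])
  also have "\<dots> = 1 - (\<Sum>i<m. (1 - p) ^ i * p)"
    using assms measure_pmf.prob_compl[of "{..<m}" "geometric_pmf p"]
    by (simp add: measure_measure_pmf_finite pmf_geometric Compl_eq_Diff_UNIV)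
  also have "(\<Sum>i<m. (1 - p) ^ i * p) = 1 - (1 - p) ^ m"
    using one_diff_power_eq[of "1 - p" m] by (simp add: mult.commute flip: sum_distrib_left)
  finally show ?thesis by simp
qed

text \<open>A natural number exceeds \<open>x \<ge> 0\<close> exactly when it is at least
  \<open>\<lfloor>x\<rfloor> + 1\<close>. Convergence of tails thus becomes convergence of
  distribution functions.\<close>

lemma cdf_distr_nat:
  fixes Z :: "'a \<Rightarrow> nat"
  assumes "prob_space P" and [measurable]: "Z \<in> measurable P (count_space UNIV)"
  shows "cdf (distr P borel (\<lambda>\<omega>. real (Z \<omega>))) x
    = (if x < 0 then 0 else 1 - \<P>(\<omega> in P. Suc (nat \<lfloor>x\<rfloor>) \<le> Z \<omega>))"
proof -
  interpret prob_space P by fact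
  have "cdf (distr P borel (\<lambda>\<omega>. real (Z \<omega>))) x = \<P>(\<omega> in P. real (Z \<omega>) \<le> x)"
    by (auto simp: cdf_def measure_distr intro!: arg_cong[where f = prob])
  also have "\<dots> = (if x < 0 then 0 else 1 - \<P>(\<omega> in P. Suc (nat \<lfloor>x\<rfloor>) \<le> Z \<omega>))"
  proof (cases "x < 0")
    case True
    then have "{\<omega> \<in> space P. real (Z \<omega>) \<le> x} = {}" by auto
    then show ?thesis using True by (metis measure_empty)
  next
    case False
    then have "real (Z \<omega>) \<le> x \<longleftrightarrow> \<not> Suc (nat \<lfloor>x\<rfloor>) \<le> Z \<omega>" for \<omega>
      by (simp add: not_less_eq_eq le_nat_iff le_floor_iff)
    then show ?thesis using False by (simp only: if_False) (rule prob_neg, measurable)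
  qed
  finally show ?thesis .
qed

theorem theorem2p1:
  fixes M :: nat
    and \<pi> :: "nat \<Rightarrow> nat \<Rightarrow> real"
    and P :: "nat \<Rightarrow> 'a measure"
    and I :: "nat \<Rightarrow> nat \<Rightarrow> 'a \<Rightarrow> nat"
    and c :: real
  assumes "nonincreasing_transitions M \<pi>"
    and "\<And>n. n \<ge> M \<Longrightarrow> nonincreasing_chain_from M \<pi> n (P n) (I n)"
    and "\<And>k. k \<ge> M + 1 \<Longrightarrow> (\<lambda>n. visit_prob (P n) (I n) k) \<longlonglongrightarrow> 0"
    and "(\<lambda>n. \<pi> n n) \<longlonglongrightarrow> 0"
    and "(\<lambda>n. \<pi> n n / \<pi> n M) \<longlonglongrightarrow> c"
    and "c > 0"
  shows "weak_conv_m
           (\<lambda>n. distr (P n) borel (\<lambda>\<omega>. real (zero_decrements M (I n) \<omega>)))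
           (distr (measure_pmf (geometric_pmf (1 / (c + 1)))) borel real)
         \<and> (\<forall>m. pmf (geometric_pmf (1 / (c + 1))) m = 1 / (c + 1) * (c / (c + 1)) ^ m)"
proof -
  interpret nonincreasing_family M \<pi> P I
    using assms(1,2) by unfold_locales
  let ?p = "1 / (c + 1)"
  have p: "0 < ?p" "?p \<le> 1" "1 - ?p = c / (c + 1)"
    using \<open>c > 0\<close> by (auto simp: field_simps)
  have prob: "prob_space (P n)" if "M \<le> n" for n
    using chain_at[OF that] by (simp add: nonincreasing_chain_def)
  \<comment> \<open>Convergence holds at every \<open>x\<close>, including the jumps of the
    limit.\<close>
  have "(\<lambda>n. cdf (distr (P n) borel (\<lambda>\<omega>. real (zero_decrements M (I n) \<omega>))) x)
      \<longlonglongrightarrow> cdf (distr (measure_pmf (geometric_pmf ?p)) borel real) x" for x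
  proof -
    let ?F = "\<lambda>t. if x < 0 then 0 else 1 - t :: real"
    have "(\<lambda>n. ?F (tail n (Suc (nat \<lfloor>x\<rfloor>)))) \<longlonglongrightarrow> ?F ((c / (c + 1)) ^ Suc (nat \<lfloor>x\<rfloor>))"
      using tail_limit[OF assms(3,5,6), of "Suc (nat \<lfloor>x\<rfloor>)"] by (auto intro: tendsto_diff)
    moreover have "?F ((c / (c + 1)) ^ Suc (nat \<lfloor>x\<rfloor>))
        = cdf (distr (measure_pmf (geometric_pmf ?p)) borel real) x"
      using cdf_distr_nat[of "measure_pmf (geometric_pmf ?p)" "\<lambda>i. i" x] prob_geometric_ge[OF p(1,2)] p(3)
      by (simp add: measure_pmf.prob_space_axioms del: power_Suc)
    \<comment> \<open>Only \<open>n \<ge> M\<close> is covered, since the chains are given only for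
      such \<open>n\<close>.\<close>
    moreover have "\<forall>\<^sub>F n in sequentially. ?F (tail n (Suc (nat \<lfloor>x\<rfloor>)))
        = cdf (distr (P n) borel (\<lambda>\<omega>. real (zero_decrements M (I n) \<omega>))) x"
      unfolding eventually_sequentially
      by (intro exI[of _ M] allI impI) (simp add: cdf_distr_nat prob prob_zero_decrements)
    ultimately show ?thesis by (simp only: Lim_transform_eventually)
  qed
  then show ?thesis
    using p by (auto simp: weak_conv_m_def weak_conv_def pmf_geometric)
qed

end
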